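(* Let $d$ be a positive integer. For positive integers $n,p$ let $\mu_{n,p}$ and $\mu_p$ be probability measures on $(\mathbb{R}^d,\mathcal{R}^d)$ with distribution functions $F_{n,p}$ and $F_p$, respectively. Assume that the collection $\{\mu_p\}$ is relatively compact with respect to the total variation metric. Then the following are equivalent: (i) $\mu_{n,p}\Longrightarrow\mu_p$ uniformly-over-$p$. (ii) For every bounded and uniformly continuous function $f:\mathbb{R}^d\to\mathbb{R}$, $\lim_{n\to\infty}\sup_p\left|\int f\,\mathrm{d}\mu_{n,p}-\int f\,\mathrm{d}\mu_p\right|=0$. (iii) For every continuous function $f:\mathbb{R}^d\to\mathbb{R}$ which is zero outside of a compact set, $\lim_{n\to\infty}\sup_p\left|\int f\,\mathrm{d}\mu_{n,p}-\int f\,\mathrm{d}\mu_p\right|=0$. (iv) For every bounded and Lipschitz continuous function $f:\mathbb{R}^d\to\mathbb{R}$, $\lim_{n\to\infty}\sup_p\left|\int f\,\mathrm{d}\mu_{n,p}-\int f\,\mathrm{d}\mu_p\right|=0$. (v) For every Borel set $A$ which is a $\mu_p$-continuity set for all $p$, $\lim_{n\to\infty}\sup_p|\mu_{n,p}(A)-\mu_p(A)|=0$. (vi) For every $\mathbf{x}\in\mathbb{R}^d$ which is a continuity point of $F_p$ for all $p$, $\lim_{n\to\infty}\sup_p|F_{n,p}(\mathbf{x})-F_p(\mathbf{x})|=0$.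
   Context: The indices $n$ and $p$ range over the positive integers. $\mathcal{R}^d$ is the Borel sigma-field on $\mathbb{R}^d$. By definition, $\mu_{n,p}\Longrightarrow\mu_p$ uniformly-over-$p$ means that for every bounded continuous function $f:\mathbb{R}^d\to\mathbb{R}$, $\lim_{n\to\infty}\sup_p\left|\int f\,\mathrm{d}\mu_{n,p}-\int f\,\mathrm{d}\mu_p\right|=0$. Relative compactness of $\{\mu_p\}$ with respect to the total variation metric means: every sequence $\{\mu_{p_n}\}$ in $\{\mu_p\}$ has a subsequence $\{\mu_{p_{n_k}}\}$ such that $\sup_{C\in\mathcal{R}^d}|\mu_{p_{n_k}}(C)-\nu(C)|\to 0$ as $k\to\infty$ for some probability measure $\nu$ on $\mathbb{R}^d$ ($\nu$ need not belong to $\{\mu_p\}$). A Borel set $A$ is a $\mu$-continuity set if $\mu(\partial A)=0$, where $\partial A$ is the topological boundary of $A$. The distribution function of a probability measure $\mu$ on $\mathbb{R}^d$ is $F(\mathbf{x})=\mu(\{\mathbf{y}: y_i\le x_i,\ i=1,\ldots,d\})$. *)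

theory Defs
  imports "HOL-Probability.Probability"
begin

definition borel_prob :: "'a::topological_space measure \<Rightarrow> bool" where
  "borel_prob M \<longleftrightarrow> prob_space M \<and> sets M = sets borel"

(* The supremum is over a set of reals bounded above (by 1) whenever M and N are
   probability measures, so the conditionally complete SUP is the true supremum. *)
definition tv_dist :: "'a::topological_space measure \<Rightarrow> 'a measure \<Rightarrow> real" where
  "tv_dist M N = (SUP C\<in>sets borel. \<bar>measure M C - measure N C\<bar>)"

(* The limit N need not belong to S. *)
definition tv_relatively_compact :: "'a::topological_space measure set \<Rightarrow> bool" where
  "tv_relatively_compact S \<longleftrightarrow>
     (\<forall>X :: nat \<Rightarrow> 'a measure. range X \<subseteq> S \<longrightarrow>
        (\<exists>r N. strict_mono r \<and> borel_prob N \<and> (\<lambda>k. tv_dist (X (r k)) N) \<longlonglongrightarrow> 0))"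

(* The parameter p ranges over the positive integers, so values at p = 0 are ignored;
   the value at n = 0 does not affect the limit.  In every use below, for n \<ge> 1 the
   differences are bounded in p, so the real-valued SUP is the true supremum. *)
definition converges_uniformly_over_p :: "(nat \<Rightarrow> nat \<Rightarrow> real) \<Rightarrow> (nat \<Rightarrow> real) \<Rightarrow> bool" where
  "converges_uniformly_over_p a b \<longleftrightarrow> (\<lambda>n. SUP p\<in>{1..}. \<bar>a n p - b p\<bar>) \<longlonglongrightarrow> 0"

definition weak_conv_uniformly_over_p ::
    "(nat \<Rightarrow> nat \<Rightarrow> 'a::topological_space measure) \<Rightarrow> (nat \<Rightarrow> 'a measure) \<Rightarrow> bool" where
  "weak_conv_uniformly_over_p M N \<longleftrightarrow>
     (\<forall>f :: 'a \<Rightarrow> real. continuous_on UNIV f \<and> bounded (range f) \<longrightarrow>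
        converges_uniformly_over_p (\<lambda>n p. \<integral>x. f x \<partial>M n p) (\<lambda>p. \<integral>x. f x \<partial>N p))"

definition continuity_set :: "'a::topological_space measure \<Rightarrow> 'a set \<Rightarrow> bool" where
  "continuity_set M A \<longleftrightarrow> A \<in> sets borel \<and> measure M (frontier A) = 0"

definition distribution_function :: "(real ^ 'd) measure \<Rightarrow> real ^ 'd \<Rightarrow> real" where
  "distribution_function M x = measure M {y. \<forall>i. y $ i \<le> x $ i}"

end

theory Submission
  imports Defs
begin

text \<open>
  Uniformity over \<open>p\<close> is first traded for sequences. If \<open>n k\<close> increases strictly and the \<open>p k\<close> are such that
  $N_{p_k} \to \nu$ in total variation, uniform convergence makes
  $M_{n_k,p_k}$ close to $N_{p_k}$, hence to $\nu$, in the sense of the condition at hand. Conversely, a failure of uniform convergence yields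
  indices at which the difference stays away from zero, and relative compactness thins them out
  until $N_{p_k}$ converges (lemma \<open>converges_uniformly_iff_along\<close>). So each of the six conditions says
  that, along all such index sequences, $P_k = M_{n_k,p_k}$ converges to $\nu$ on a certain class of
  functions or sets, and the claim becomes a portmanteau theorem for \<open>P\<close> and \<open>\<nu>\<close>.

  All conditions are compared with one: $\liminf_k P_k(U) \ge \nu(U)$ for every open \<open>U\<close>. It implies
  convergence on \<open>\<nu>\<close>-continuity sets (\<open>continuity_set_tendsto\<close>) and of integrals of bounded continuous
  functions (\<open>integral_tendsto_of_open_liminf\<close>). It follows from convergence for compactly supported
  Lipschitz functions (\<open>open_liminf_ge_of_test_functions\<close>), hence from each of the conditions on functions.
  It also follows from convergence on the orthants at points with coordinates in a
  dense set (\<open>open_liminf_ge_of_orthants\<close>): orthants are closed under intersection, so inclusion-exclusion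
  gives convergence on their finite unions, then on half-open boxes, then on finite unions of boxes,
  and every open set is a countable union of boxes.

  Conditions on sets and on points speak about the measures $N_p$ rather than about $\nu$. In one direction
  total variation convergence is what transfers null frontiers from all $N_p$ to $\nu$. In the
  other, there must be enough common continuity points: since the $N_p$ are countably many, all but
  countably many coordinates avoid the atoms of every marginal
  (\<open>common_continuity_coordinates_dense\<close>).
\<close>

section \<open>Setwise convergence\<close>

lemma borel_probD:
  assumes "borel_prob M"
  shows "prob_space M" "sets M = sets borel" "space M = UNIV"
  using assms sets_eq_imp_space_eq[of M borel] by (auto simp: borel_prob_def)

lemma borel_prob_measurable:
  assumes "borel_prob M" and "f \<in> borel_measurable borel"
  shows "f \<in> borel_measurable M"
  using assms measurable_cong_sets[OF borel_probD(2)[OF assms(1)] refl] by blast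

lemma measure_tendsto_of_tv_dist:
  assumes X: "\<And>k. borel_prob (X k)" and N: "borel_prob N"
    and tv: "(\<lambda>k. tv_dist (X k) N) \<longlonglongrightarrow> 0" and C: "C \<in> sets borel"
  shows "(\<lambda>k. measure (X k) C) \<longlonglongrightarrow> measure N C"
proof -
  have le1: "\<bar>measure (X k) C' - measure N C'\<bar> \<le> 1" for k C'
  proof -
    interpret X: prob_space "X k" using X borel_probD by blast
    interpret N: prob_space N using N borel_probD by blast
    show ?thesis
      using X.prob_le_1[of C'] N.prob_le_1[of C'] measure_nonneg[of "X k" C'] measure_nonneg[of N C']
      by linarith
  qed
  have le: "\<bar>measure (X k) C - measure N C\<bar> \<le> tv_dist (X k) N" for k
    unfolding tv_dist_def using C le1 by (intro cSUP_upper) (auto intro!: bdd_aboveI)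
  have "(\<lambda>k. measure (X k) C - measure N C) \<longlonglongrightarrow> 0"
    by (rule Lim_null_comparison[OF _ tv]) (use le in auto)
  then show ?thesis by (simp add: LIM_zero_iff)
qed

section \<open>Weak convergence through open sets\<close>

text \<open>
  The open-set condition $\liminf_k P_k(U) \ge \nu(U)$ of the portmanteau theorem.
\<close>

definition open_liminf_ge :: "(nat \<Rightarrow> 'a::topological_space measure) \<Rightarrow> 'a measure \<Rightarrow> bool" where
  "open_liminf_ge P \<nu> \<longleftrightarrow>
     (\<forall>U. open U \<longrightarrow> (\<forall>e>0. \<forall>\<^sub>F k in sequentially. measure \<nu> U - e < measure (P k) U))"

text \<open>
  A sequence that converges in total variation meets the open-set condition,
  so the lemmas below also apply to the limit measures themselves.
\<close>

lemma open_liminf_ge_if_setwise: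
  assumes "\<And>U. open U \<Longrightarrow> (\<lambda>k. measure (P k) U) \<longlonglongrightarrow> measure \<nu> U"
  shows "open_liminf_ge P \<nu>"
  unfolding open_liminf_ge_def
  by (intro allI impI order_tendstoD(1)[OF assms]) auto

text \<open>
  The interior of \<open>A\<close> and the complement of its closure are open, and the open-set condition for
  them bounds $P_k(A)$ from below and from above. When the frontier is null, both bounds
  tend to $\nu(A)$.
\<close>

lemma continuity_set_tendsto:
  fixes P :: "nat \<Rightarrow> 'a::topological_space measure"
  assumes P: "\<And>k. borel_prob (P k)" and \<nu>: "borel_prob \<nu>" and lim: "open_liminf_ge P \<nu>"
    and A: "A \<in> sets borel" and null: "measure \<nu> (frontier A) = 0"
  shows "(\<lambda>k. measure (P k) A) \<longlonglongrightarrow> measure \<nu> A"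
proof (rule tendstoI)
  fix e :: real assume e: "e > 0"
  interpret \<nu>: prob_space \<nu> using \<nu> borel_probD by blast
  note sets\<nu>[simp] = borel_probD(2)[OF \<nu>] and space\<nu>[simp] = borel_probD(3)[OF \<nu>]
  have sub: "interior A \<subseteq> A" "A \<subseteq> closure A" by (rule interior_subset closure_subset)+
  have "measure \<nu> (frontier A) = measure \<nu> (closure A) - measure \<nu> (interior A)"
    unfolding frontier_def using sub by (intro \<nu>.finite_measure_Diff) auto
  moreover have "measure \<nu> (interior A) \<le> measure \<nu> A" "measure \<nu> A \<le> measure \<nu> (closure A)"
    using A sub by (auto intro!: \<nu>.finite_measure_mono)
  ultimately have eq: "measure \<nu> (interior A) = measure \<nu> A" "measure \<nu> (closure A) = measure \<nu> A"
    using null by auto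
  have c: "measure \<nu> (- closure A) = 1 - measure \<nu> A"
    using \<nu>.prob_compl[of "closure A"] eq by (simp add: Compl_eq_Diff_UNIV)
  have "\<forall>\<^sub>F k in sequentially. measure \<nu> (interior A) - e < measure (P k) (interior A)"
    and "\<forall>\<^sub>F k in sequentially. measure \<nu> (- closure A) - e < measure (P k) (- closure A)"
    using lim e unfolding open_liminf_ge_def by (auto simp: open_Compl)
  then show "\<forall>\<^sub>F k in sequentially. dist (measure (P k) A) (measure \<nu> A) < e"
  proof eventually_elim
    case (elim k)
    interpret P: prob_space "P k" using P borel_probD by blast
    note [simp] = borel_probD(2)[OF P] borel_probD(3)[OF P]
    have "measure (P k) (interior A) \<le> measure (P k) A"
      using A sub by (auto intro!: P.finite_measure_mono)
    moreover have "measure (P k) A \<le> measure (P k) (closure A)"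
      using A sub by (auto intro!: P.finite_measure_mono)
    moreover have "measure (P k) (- closure A) = 1 - measure (P k) (closure A)"
      using P.prob_compl[of "closure A"] by (simp add: Compl_eq_Diff_UNIV)
    ultimately show ?case using elim eq c by (auto simp: dist_real_def)
  qed
qed

lemma frontier_sublevel_subset:
  fixes f :: "'a::topological_space \<Rightarrow> real"
  assumes "continuous_on UNIV f"
  shows "frontier {x. f x \<le> t} \<subseteq> {x. f x = t}"
proof -
  have "closed {x. f x \<le> t}" "open {x. f x < t}"
    using assms by (auto intro!: closed_Collect_le open_Collect_less continuous_on_const)
  then have "closure {x. f x \<le> t} = {x. f x \<le> t}"
    and "{x. f x < t} \<subseteq> interior {x. f x \<le> t}"
    by (simp, intro interior_maximal) auto
  then show ?thesis unfolding frontier_def by (auto simp: subset_iff) (metis order_le_less)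
qed

text \<open>
  Pushing forward by \<open>f\<close> reduces the claim to measures on the real line: the frontier of
  a sublevel set of \<open>f\<close> lies in a level set, so the distribution functions of the images
  converge at every continuity point of the limit, and this implies convergence of integrals there.
\<close>

lemma integral_tendsto_of_open_liminf:
  fixes P :: "nat \<Rightarrow> 'a::topological_space measure" and f :: "'a \<Rightarrow> real"
  assumes P: "\<And>k. borel_prob (P k)" and \<nu>: "borel_prob \<nu>" and lim: "open_liminf_ge P \<nu>"
    and f: "continuous_on UNIV f" and bdd: "bounded (range f)"
  shows "(\<lambda>k. \<integral>x. f x \<partial>P k) \<longlonglongrightarrow> (\<integral>x. f x \<partial>\<nu>)"
proof -
  obtain B where B: "\<bar>f x\<bar> \<le> B" for x using bdd by (auto simp: bounded_iff)
  have fb: "f \<in> borel_measurable borel" using f by (rule borel_measurable_continuous_onI)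
  have rd: "real_distribution (distr Q borel f)" and fm: "f \<in> borel_measurable Q"
    and cdf: "cdf (distr Q borel f) t = measure Q {x. f x \<le> t}"
    and pt: "measure (distr Q borel f) {t} = measure Q {x. f x = t}"
    \<comment> \<open>the identity is truncated at a bound of \<open>f\<close> to become a bounded test function\<close>
    and int: "(\<integral>t. max (- B) (min B t) \<partial>distr Q borel f) = (\<integral>x. f x \<partial>Q)"
    if Q: "borel_prob Q" for Q t
  proof -
    show fm: "f \<in> borel_measurable Q"
      using Q fb by (rule borel_prob_measurable)
    interpret prob_space Q using borel_probD Q by blast
    show "real_distribution (distr Q borel f)" using fm by simp
    show "cdf (distr Q borel f) t = measure Q {x. f x \<le> t}"
      using fm borel_probD(3)[OF Q] by (simp add: cdf_def measure_distr vimage_def)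
    show "measure (distr Q borel f) {t} = measure Q {x. f x = t}"
      using fm borel_probD(3)[OF Q] by (simp add: measure_distr vimage_def)
    have "max (- B) (min B (f x)) = f x" for x using B[of x] by linarith
    then show "(\<integral>t. max (- B) (min B t) \<partial>distr Q borel f) = (\<integral>x. f x \<partial>Q)"
      using fm by (subst integral_distr) auto
  qed
  interpret D: real_distribution "distr \<nu> borel f" by (rule rd[OF \<nu>])
  have "weak_conv_m (\<lambda>k. distr (P k) borel f) (distr \<nu> borel f)"
    unfolding weak_conv_m_def weak_conv_def
  proof (intro allI impI)
    fix t assume "isCont (cdf (distr \<nu> borel f)) t"
    then have 0: "measure \<nu> {x. f x = t} = 0" using D.isCont_cdf pt[OF \<nu>] by simp
    interpret \<nu>: prob_space \<nu> using \<nu> borel_probD by blast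
    have "measure \<nu> (frontier {x. f x \<le> t}) \<le> measure \<nu> {x. f x = t}"
      using fb borel_probD(2)[OF \<nu>]
      by (intro \<nu>.finite_measure_mono frontier_sublevel_subset f) (auto simp: vimage_def)
    then have "measure \<nu> (frontier {x. f x \<le> t}) = 0" using 0 measure_nonneg[of \<nu>] by (metis antisym)
    then have "(\<lambda>k. measure (P k) {x. f x \<le> t}) \<longlonglongrightarrow> measure \<nu> {x. f x \<le> t}"
      using fb by (intro continuity_set_tendsto[OF P \<nu> lim]) auto
    then show "(\<lambda>k. cdf (distr (P k) borel f) t) \<longlonglongrightarrow> cdf (distr \<nu> borel f) t"
      by (simp add: cdf[OF P] cdf[OF \<nu>])
  qed
  then have "(\<lambda>k. \<integral>t. max (- B) (min B t) \<partial>distr (P k) borel f)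
      \<longlonglongrightarrow> (\<integral>t. max (- B) (min B t) \<partial>distr \<nu> borel f)"
    using B[of undefined]
    by (intro weak_conv_imp_integral_bdd_continuous_conv[where B=B] rd P \<nu> continuous_intros) auto
  then show ?thesis by (simp add: int[OF P] int[OF \<nu>])
qed

text \<open>
  The indicator of an open set is a limit from below of compactly supported Lipschitz functions.
  So the test functions common to the weakest conditions, Lipschitz with compact support,
  already give the open-set condition.
\<close>

lemma open_liminf_ge_of_test_functions:
  fixes P :: "nat \<Rightarrow> 'a::euclidean_space measure"
  assumes P: "\<And>k. borel_prob (P k)" and \<nu>: "borel_prob \<nu>"
    and conv: "\<And>\<phi> L K. L-lipschitz_on UNIV \<phi> \<Longrightarrow> (\<And>x. 0 \<le> \<phi> x \<and> \<phi> x \<le> (1::real)) \<Longrightarrow>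
      compact K \<Longrightarrow> (\<And>x. x \<notin> K \<Longrightarrow> \<phi> x = 0) \<Longrightarrow> (\<lambda>k. \<integral>x. \<phi> x \<partial>P k) \<longlonglongrightarrow> (\<integral>x. \<phi> x \<partial>\<nu>)"
  shows "open_liminf_ge P \<nu>"
  unfolding open_liminf_ge_def
proof (intro allI impI)
  fix U :: "'a set" and e :: real assume U: "open U" and e: "e > 0"
  note [simp] = borel_probD(2)[OF \<nu>] borel_probD(3)[OF \<nu>] borel_probD(2)[OF P] borel_probD(3)[OF P]
  interpret \<nu>: prob_space \<nu> using \<nu> borel_probD by blast
  interpret P: prob_space "P k" for k using P borel_probD by blast
  show "\<forall>\<^sub>F k in sequentially. measure \<nu> U - e < measure (P k) U"
  proof (cases "U = UNIV")
    case True
    then show ?thesis using e P.prob_space \<nu>.prob_space by simp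
  next
    case False
    \<comment> \<open>The distance to the complement is cut off at radius \<open>m\<close> to obtain compact support. It would
      vanish for \<open>U = UNIV\<close>, as the distance to the empty set is \<open>0\<close> by convention.\<close>
    define \<phi> where "\<phi> m x = min (min 1 (real m * infdist x (- U))) (max 0 (real m - norm x))" for m x
    have lip: "(real m + 1)-lipschitz_on UNIV (\<phi> m)" for m
    proof (rule lipschitz_onI)
      fix x y :: 'a
      have "real m * \<bar>infdist x (- U) - infdist y (- U)\<bar> \<le> real m * dist x y"
        by (intro mult_left_mono infdist_triangle_abs) simp
      then have "\<bar>real m * infdist x (- U) - real m * infdist y (- U)\<bar> \<le> real m * dist x y"
        by (simp add: abs_mult flip: right_diff_distrib)
      moreover have "\<bar>norm x - norm y\<bar> \<le> dist x y" by (simp add: dist_norm norm_triangle_ineq3)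
      moreover have "0 \<le> real m * dist x y" by simp
      moreover have "(real m + 1) * dist x y = real m * dist x y + dist x y" by (simp add: algebra_simps)
      ultimately show "dist (\<phi> m x) (\<phi> m y) \<le> (real m + 1) * dist x y"
        unfolding \<phi>_def dist_real_def by linarith
    qed simp
    have cont: "continuous_on UNIV (\<phi> m)" for m using lip by (rule lipschitz_on_continuous_on)
    have ran: "0 \<le> \<phi> m x \<and> \<phi> m x \<le> 1" for m x
      using infdist_nonneg[of x "- U"] by (auto simp: \<phi>_def)
    have zero: "\<phi> m x = 0" if "x \<notin> U" for m x using that by (simp add: \<phi>_def)
    have le_ind: "\<phi> m x \<le> indicator U x" for m x using ran zero by (auto simp: indicator_def)
    have supp: "\<phi> m x = 0" if "x \<notin> cball 0 (real m)" for m x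
      using that infdist_nonneg[of x "- U"] by (auto simp: \<phi>_def)
    have meas: "\<phi> m \<in> borel_measurable borel" for m using cont by (rule borel_measurable_continuous_onI)
    have one: "\<forall>\<^sub>F m in sequentially. \<phi> m x = 1" if x: "x \<in> U" for x
    proof -
      have pos: "infdist x (- U) > 0"
        using False U x by (intro infdist_pos_not_in_closed) auto
      have large: "\<forall>\<^sub>F m in sequentially. c \<le> real m" for c
        using filterlim_real_sequentially by (simp add: filterlim_at_top)
      show ?thesis
        using large[of "1 / infdist x (- U)"] large[of "norm x + 1"]
      proof eventually_elim
        case (elim m)
        then have "1 \<le> real m * infdist x (- U)" using pos by (simp add: pos_divide_le_eq)
        then show ?case using elim by (simp add: \<phi>_def)
      qed
    qed
    have "(\<lambda>m. \<integral>x. \<phi> m x \<partial>\<nu>) \<longlonglongrightarrow> (\<integral>x. indicator U x \<partial>\<nu>)"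
    proof (rule integral_dominated_convergence[where w = "\<lambda>_. 1"])
      show "AE x in \<nu>. (\<lambda>m. \<phi> m x) \<longlonglongrightarrow> indicator U x"
      proof (rule AE_I2)
        fix x show "(\<lambda>m. \<phi> m x) \<longlonglongrightarrow> indicator U x"
          using one[of x] zero[of x] by (cases "x \<in> U") (auto intro: tendsto_eventually)
      qed
    qed (use U ran borel_prob_measurable[OF \<nu> meas] in \<open>auto intro!: borel_measurable_indicator\<close>)
    then have "(\<lambda>m. \<integral>x. \<phi> m x \<partial>\<nu>) \<longlonglongrightarrow> measure \<nu> U" using U by simp
    from order_tendstoD(1)[OF this, of "measure \<nu> U - e"] e
    obtain m where m: "measure \<nu> U - e < (\<integral>x. \<phi> m x \<partial>\<nu>)"
      by (auto simp: eventually_sequentially)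
    have "(\<lambda>k. \<integral>x. \<phi> m x \<partial>P k) \<longlonglongrightarrow> (\<integral>x. \<phi> m x \<partial>\<nu>)"
      using ran supp by (intro conv[OF lip, of _ "cball 0 (real m)"]) auto
    from order_tendstoD(1)[OF this m] show ?thesis
    proof eventually_elim
      case (elim k)
      have "(\<integral>x. \<phi> m x \<partial>P k) \<le> (\<integral>x. indicator U x \<partial>P k)"
      proof (rule integral_mono)
        show "integrable (P k) (\<phi> m)"
          using ran borel_prob_measurable[OF P meas] by (intro P.integrable_const_bound[where B=1]) auto
      qed (use U le_ind in \<open>auto simp: less_top[symmetric]\<close>)
      also have "\<dots> = measure (P k) U" using U by simp
      finally show ?case using elim by simp
    qed
  qed
qed

section \<open>Intersection-closed families of sets\<close>

text \<open>
  By inclusion-exclusion for two sets: the union over \<open>insert i I\<close> is handled by the union over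
  \<open>I\<close> of the sets \<open>f j\<close> and of the sets \<open>f i \<inter> f j\<close>, which again belong to the family.
  Hence the induction lets \<open>f\<close> vary.
\<close>

lemma measure_finite_UN_tendsto:
  fixes P :: "nat \<Rightarrow> 'a::topological_space measure"
  assumes P: "\<And>k. borel_prob (P k)" and \<nu>: "borel_prob \<nu>"
    and \<B>: "\<B> \<subseteq> sets borel" and Int: "\<And>A B. A \<in> \<B> \<Longrightarrow> B \<in> \<B> \<Longrightarrow> A \<inter> B \<in> \<B>"
    and lim: "\<And>B. B \<in> \<B> \<Longrightarrow> (\<lambda>k. measure (P k) B) \<longlonglongrightarrow> measure \<nu> B"
    and "finite I" and "\<And>i. i \<in> I \<Longrightarrow> f i \<in> \<B>"
  shows "(\<lambda>k. measure (P k) (\<Union>i\<in>I. f i)) \<longlonglongrightarrow> measure \<nu> (\<Union>i\<in>I. f i)"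
  using assms(6,7)
proof (induction I arbitrary: f)
  case empty
  then show ?case by simp
next
  case (insert i I)
  have un: "measure Q (\<Union>j\<in>insert i I. f j)
      = measure Q (f i) + measure Q (\<Union>j\<in>I. f j) - measure Q (\<Union>j\<in>I. f i \<inter> f j)"
    if Q: "borel_prob Q" for Q
  proof -
    interpret prob_space Q using Q borel_probD by blast
    have "f i \<in> sets Q" "(\<Union>j\<in>I. f j) \<in> sets Q"
      using insert.prems insert.hyps \<B> borel_probD(2)[OF Q] by (auto intro!: sets.finite_UN)
    then show ?thesis
      using measure_Un3[of "f i" Q "\<Union>j\<in>I. f j"] by (simp add: fmeasurable_eq_sets)
  qed
  show ?case unfolding un[OF P] un[OF \<nu>]
    using insert.prems by (intro tendsto_intros lim insert.IH Int) auto
qed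

text \<open>
  An open set is exhausted from inside, up to small \<open>\<nu>\<close>-measure, by a finite union of
  members of the family, and on such unions the measures converge.
\<close>

lemma open_liminf_ge_of_Int_closed:
  fixes P :: "nat \<Rightarrow> 'a::topological_space measure"
  assumes P: "\<And>k. borel_prob (P k)" and \<nu>: "borel_prob \<nu>"
    and \<B>: "\<B> \<subseteq> sets borel" and Int: "\<And>A B. A \<in> \<B> \<Longrightarrow> B \<in> \<B> \<Longrightarrow> A \<inter> B \<in> \<B>"
    and lim: "\<And>B. B \<in> \<B> \<Longrightarrow> (\<lambda>k. measure (P k) B) \<longlonglongrightarrow> measure \<nu> B"
    and cover: "\<And>U. open U \<Longrightarrow> \<exists>f :: nat \<Rightarrow> 'a set. range f \<subseteq> \<B> \<and> (\<Union>i. f i) = U"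
  shows "open_liminf_ge P \<nu>"
  unfolding open_liminf_ge_def
proof (intro allI impI)
  fix U :: "'a set" and e :: real assume U: "open U" and e: "e > 0"
  interpret \<nu>: prob_space \<nu> using \<nu> borel_probD by blast
  obtain f :: "nat \<Rightarrow> 'a set" where f: "range f \<subseteq> \<B>" "(\<Union>i. f i) = U" using cover[OF U] by blast
  have fb: "f i \<in> sets borel" for i using f \<B> by blast
  have "(\<lambda>n. measure \<nu> (\<Union>i<n. f i)) \<longlonglongrightarrow> measure \<nu> (\<Union>n. \<Union>i<n. f i)"
    using fb by (intro \<nu>.finite_Lim_measure_incseq monoI UN_mono) (auto simp: borel_probD(2)[OF \<nu>])
  moreover have "(\<Union>n. \<Union>i<n. f i) = U" using f(2) by auto
  ultimately have "(\<lambda>n. measure \<nu> (\<Union>i<n. f i)) \<longlonglongrightarrow> measure \<nu> U" by simp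
  from order_tendstoD(1)[OF this, of "measure \<nu> U - e"] e
  obtain n where n: "measure \<nu> U - e < measure \<nu> (\<Union>i<n. f i)"
    by (auto simp: eventually_sequentially)
  have "(\<lambda>k. measure (P k) (\<Union>i<n. f i)) \<longlonglongrightarrow> measure \<nu> (\<Union>i<n. f i)"
    using f by (intro measure_finite_UN_tendsto[OF P \<nu> \<B> Int lim]) auto
  from order_tendstoD(1)[OF this n]
  show "\<forall>\<^sub>F k in sequentially. measure \<nu> U - e < measure (P k) U"
  proof eventually_elim
    case (elim k)
    interpret P: prob_space "P k" using P borel_probD by blast
    have "measure (P k) (\<Union>i<n. f i) \<le> measure (P k) U"
      using f(2) U by (intro P.finite_measure_mono) (auto simp: borel_probD(2)[OF P])
    then show ?case using elim by simp
  qed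
qed

section \<open>Orthants and half-open boxes\<close>

definition orthant :: "real ^ 'd \<Rightarrow> (real ^ 'd) set" where
  "orthant x = {y. \<forall>i. y $ i \<le> x $ i}"

definition half_open_box :: "real ^ 'd \<Rightarrow> real ^ 'd \<Rightarrow> (real ^ 'd) set" where
  "half_open_box a b = {y. \<forall>i. a $ i < y $ i \<and> y $ i \<le> b $ i}"

lemma closed_orthant: "closed (orthant x)"
  unfolding orthant_def
  by (intro closed_Collect_all closed_Collect_le continuous_intros)

lemma orthant_borel [measurable, simp]: "orthant x \<in> sets borel"
  by (intro borel_closed closed_orthant)

text \<open>
  Orthants are closed under intersection but not under difference. Writing a box as one orthant
  minus a finite union of smaller orthants makes the convergence on boxes a consequence
  of the convergence on finite unions. The minimum keeps the smaller orthants inside the large one,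
  so that the measure of the difference is the difference of the measures.
\<close>

lemma half_open_box_eq_orthants:
  "half_open_box a b = orthant b - (\<Union>i. orthant (\<chi> j. if j = i then min (a $ i) (b $ i) else b $ j))"
proof (rule set_eqI)
  fix y
  have "y \<in> orthant (\<chi> j. if j = i then min (a $ i) (b $ i) else b $ j) \<longleftrightarrow> y $ i \<le> a $ i"
    if "y \<in> orthant b" for i
    using that by (auto simp: orthant_def)
  then have "y \<in> orthant b - (\<Union>i. orthant (\<chi> j. if j = i then min (a $ i) (b $ i) else b $ j))
      \<longleftrightarrow> y \<in> orthant b \<and> (\<forall>i. a $ i < y $ i)"
    by (auto simp: not_le[symmetric])
  then show "y \<in> half_open_box a b \<longleftrightarrow>
      y \<in> orthant b - (\<Union>i. orthant (\<chi> j. if j = i then min (a $ i) (b $ i) else b $ j))"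
    by (auto simp: half_open_box_def orthant_def)
qed

text \<open>
  Each point of \<open>U\<close> lies in the interior of a small box in \<open>U\<close> with corner coordinates in \<open>D\<close>,
  and the Lindelof property leaves countably many of these open interiors.
  Each is replaced by its half-open box, because the half-open boxes are closed under intersection
  and have measures that orthants determine.
\<close>

lemma countable_half_open_box_cover:
  fixes U :: "(real ^ 'd) set"
  assumes dense: "\<And>s t. s < t \<Longrightarrow> \<exists>u\<in>D. s < u \<and> u < t" and U: "open U"
  shows "\<exists>f :: nat \<Rightarrow> (real ^ 'd) set.
    range f \<subseteq> {half_open_box a b | a b. \<forall>i. a $ i \<in> D \<and> b $ i \<in> D} \<and> (\<Union>n. f n) = U"
proof -
  define good where "good a b \<longleftrightarrow> (\<forall>i. a $ i \<in> D \<and> b $ i \<in> D) \<and> half_open_box a b \<subseteq> U" for a b :: "real ^ 'd"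
  define \<F> where "\<F> = {box a b | a b. good a b}"
  have sub: "box a b \<subseteq> half_open_box a b" for a b :: "real ^ 'd"
    by (auto simp: mem_box_cart half_open_box_def less_imp_le)
  have in_box: "\<exists>a b. good a b \<and> x \<in> box a b" if x: "x \<in> U" for x
  proof -
    obtain e where e: "e > 0" "ball x e \<subseteq> U" by (rule openE[OF U x])
    \<comment> \<open>In the l1 norm a box of side below \<open>2\<delta>\<close> around \<open>x\<close> stays within distance \<open>e\<close>.\<close>
    define \<delta> where "\<delta> = e / real CARD('d)"
    have \<delta>: "\<delta> > 0" using e by (simp add: \<delta>_def)
    have "\<forall>i. \<exists>s t. s \<in> D \<and> t \<in> D \<and> x $ i - \<delta> < s \<and> s < x $ i \<and> x $ i < t \<and> t < x $ i + \<delta>"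
    proof
      fix i show "\<exists>s t. s \<in> D \<and> t \<in> D \<and> x $ i - \<delta> < s \<and> s < x $ i \<and> x $ i < t \<and> t < x $ i + \<delta>"
        using dense[of "x $ i - \<delta>" "x $ i"] dense[of "x $ i" "x $ i + \<delta>"] \<delta> by auto
    qed
    then obtain a b where ab: "\<And>i. a i \<in> D" "\<And>i. b i \<in> D"
      "\<And>i. x $ i - \<delta> < a i \<and> a i < x $ i" "\<And>i. x $ i < b i \<and> b i < x $ i + \<delta>"
      by metis
    have "half_open_box (vec_lambda a) (vec_lambda b) \<subseteq> ball x e"
    proof
      fix y assume "y \<in> half_open_box (vec_lambda a) (vec_lambda b)"
      then have y: "a i < y $ i" "y $ i \<le> b i" for i by (auto simp: half_open_box_def)
      have *: "\<bar>(x - y) $ i\<bar> < \<delta>" for i using ab(3,4)[of i] y[of i] by auto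
      have "norm (x - y) \<le> (\<Sum>i\<in>UNIV. \<bar>(x - y) $ i\<bar>)" by (rule norm_le_l1_cart)
      also have "\<dots> < (\<Sum>i\<in>(UNIV :: 'd set). \<delta>)" by (rule sum_strict_mono) (use * in auto)
      also have "\<dots> = e" by (simp add: \<delta>_def)
      finally show "y \<in> ball x e" by (simp add: dist_norm)
    qed
    then have "good (vec_lambda a) (vec_lambda b)" using ab e unfolding good_def by auto
    moreover have "x \<in> box (vec_lambda a) (vec_lambda b)" using ab by (simp add: mem_box_cart)
    ultimately show ?thesis by blast
  qed
  obtain \<F>' where \<F>': "\<F>' \<subseteq> \<F>" "countable \<F>'" "\<Union>\<F>' = \<Union>\<F>"
    by (rule Lindelof[of \<F>]) (auto simp: \<F>_def open_box)
  have "\<forall>S\<in>\<F>'. \<exists>H. (\<exists>a b. good a b \<and> H = half_open_box a b) \<and> S \<subseteq> H"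
    using \<F>'(1) sub unfolding \<F>_def by blast
  then obtain h where h: "\<And>S. S \<in> \<F>' \<Longrightarrow> \<exists>a b. good a b \<and> h S = half_open_box a b"
    "\<And>S. S \<in> \<F>' \<Longrightarrow> S \<subseteq> h S" by metis
  obtain u where "u \<in> D" using dense[of 0 1] by auto
  then have empty: "\<exists>a b. {} = half_open_box a b \<and> (\<forall>i. a $ i \<in> D \<and> b $ i \<in> D)"
    by (intro exI[of _ "\<chi> i. u"]) (auto simp: half_open_box_def)
  define f where "f = from_nat_into (insert {} (h ` \<F>'))"
  have "range f = insert {} (h ` \<F>')"
    unfolding f_def by (rule range_from_nat_into) (use \<F>'(2) in auto)
  then have Un: "(\<Union>n. f n) = (\<Union>S\<in>\<F>'. h S)" by auto
  have f: "f n \<in> {half_open_box a b | a b. \<forall>i. a $ i \<in> D \<and> b $ i \<in> D}" for n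
  proof (cases "f n = {}")
    case True
    then show ?thesis using empty by simp
  next
    case False
    then obtain S where "S \<in> \<F>'" "f n = h S"
      using \<open>range f = insert {} (h ` \<F>')\<close> by blast
    then show ?thesis using h(1)[of S] unfolding good_def by auto
  qed
  moreover have "(\<Union>S\<in>\<F>'. h S) = U"
  proof
    show "(\<Union>S\<in>\<F>'. h S) \<subseteq> U" using h(1) unfolding good_def by blast
    show "U \<subseteq> (\<Union>S\<in>\<F>'. h S)"
    proof
      fix x assume "x \<in> U"
      then have "x \<in> \<Union>\<F>'" using in_box \<F>'(3) unfolding \<F>_def by blast
      then show "x \<in> (\<Union>S\<in>\<F>'. h S)" using h(2) by blast
    qed
  qed
  ultimately show ?thesis using Un by (intro exI[of _ f]) (simp add: image_subset_iff)
qed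

text \<open>
  The argument for intersection-closed families is used twice: first for orthants, which gives
  convergence on boxes, and then for boxes, which approximate open sets.
\<close>

lemma open_liminf_ge_of_orthants:
  fixes P :: "nat \<Rightarrow> (real ^ 'd) measure"
  assumes P: "\<And>k. borel_prob (P k)" and \<nu>: "borel_prob \<nu>"
    and dense: "\<And>s t. s < t \<Longrightarrow> \<exists>u\<in>D. s < u \<and> u < t"
    and lim: "\<And>x. (\<And>i. x $ i \<in> D) \<Longrightarrow> (\<lambda>k. measure (P k) (orthant x)) \<longlonglongrightarrow> measure \<nu> (orthant x)"
  shows "open_liminf_ge P \<nu>"
proof -
  define \<O> where "\<O> = {orthant x | x :: real ^ 'd. \<forall>i. x $ i \<in> D}"
  have \<O>b: "\<O> \<subseteq> sets borel" by (auto simp: \<O>_def intro!: borel_closed closed_orthant)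
  have \<O>Int: "A \<inter> B \<in> \<O>" if A: "A \<in> \<O>" and B: "B \<in> \<O>" for A B
  proof -
    obtain x y :: "real ^ 'd" where x: "A = orthant x" "\<forall>i. x $ i \<in> D" and y: "B = orthant y" "\<forall>i. y $ i \<in> D"
      using A B by (auto simp: \<O>_def)
    have "A \<inter> B = orthant (\<chi> i. min (x $ i) (y $ i))" using x y by (auto simp: orthant_def)
    then show ?thesis using x y unfolding \<O>_def by (force simp: min_def)
  qed
  have \<O>lim: "(\<lambda>k. measure (P k) B) \<longlonglongrightarrow> measure \<nu> B" if "B \<in> \<O>" for B
    using that lim by (auto simp: \<O>_def)
  define \<B> where "\<B> = {half_open_box a b | a b :: real ^ 'd. \<forall>i. a $ i \<in> D \<and> b $ i \<in> D}"
  define lower where "lower a b i = (\<chi> j. if j = i then min (a $ i) (b $ i) else b $ j)" for a b :: "real ^ 'd" and i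
  have Un_borel: "(\<Union>i. orthant (lower a b i)) \<in> sets borel" for a b
    by (intro borel_closed closed_UN) (auto intro: closed_orthant)
  have Un_sub: "(\<Union>i. orthant (lower a b i)) \<subseteq> orthant b" for a b
    by (auto simp: orthant_def lower_def)
  have eq: "half_open_box a b = orthant b - (\<Union>i. orthant (lower a b i))" for a b
    unfolding lower_def by (rule half_open_box_eq_orthants)
  have \<B>b: "\<B> \<subseteq> sets borel"
    using Un_borel closed_orthant by (auto simp: \<B>_def eq)
  have \<B>Int: "A \<inter> B \<in> \<B>" if A: "A \<in> \<B>" and B: "B \<in> \<B>" for A B
  proof -
    obtain a b c d :: "real ^ 'd" where *: "A = half_open_box a b" "B = half_open_box c d"
       "\<forall>i. a $ i \<in> D \<and> b $ i \<in> D" "\<forall>i. c $ i \<in> D \<and> d $ i \<in> D"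
      using A B by (auto simp: \<B>_def)
    have "A \<inter> B = half_open_box (\<chi> i. max (a $ i) (c $ i)) (\<chi> i. min (b $ i) (d $ i))"
      using * by (auto simp: half_open_box_def)
    then show ?thesis using * unfolding \<B>_def by (force simp: min_def max_def)
  qed
  have \<B>lim: "(\<lambda>k. measure (P k) B) \<longlonglongrightarrow> measure \<nu> B" if B: "B \<in> \<B>" for B
  proof -
    obtain a b where ab: "B = half_open_box a b" "\<And>i. a $ i \<in> D" "\<And>i. b $ i \<in> D"
      using B by (auto simp: \<B>_def)
    have diff: "measure Q B = measure Q (orthant b) - measure Q (\<Union>i. orthant (lower a b i))"
      if Q: "borel_prob Q" for Q
    proof -
      interpret prob_space Q using Q borel_probD by blast
      show ?thesis unfolding ab(1) eq
        using Un_borel Un_sub closed_orthant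
        by (intro finite_measure_Diff) (auto simp: borel_probD(2)[OF Q])
    qed
    have lower: "orthant (lower a b i) \<in> \<O>" for i
      using ab unfolding \<O>_def lower_def by (force simp: min_def)
    show ?thesis unfolding diff[OF P] diff[OF \<nu>]
      using ab lower by (intro tendsto_intros lim measure_finite_UN_tendsto[OF P \<nu> \<O>b \<O>Int \<O>lim]) auto
  qed
  show ?thesis
    by (rule open_liminf_ge_of_Int_closed[OF P \<nu> \<B>b \<B>Int \<B>lim])
      (use countable_half_open_box_cover[OF dense] in \<open>auto simp: \<B>_def\<close>)
qed

lemma distribution_function_orthant: "distribution_function Q x = measure Q (orthant x)"
  by (simp add: distribution_function_def orthant_def)

text \<open>
  If the hyperplanes through \<open>x\<close> are null, then the indicators of the orthants at points
  tending to \<open>x\<close> converge almost everywhere, and dominated convergence applies.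
\<close>

lemma isCont_distribution_function:
  fixes Q :: "(real ^ 'd) measure"
  assumes Q: "borel_prob Q" and null: "\<And>i. measure Q {y. y $ i = x $ i} = 0"
  shows "isCont (distribution_function Q) x"
  unfolding continuous_at_sequentially
proof (intro allI impI)
  fix X :: "nat \<Rightarrow> real ^ 'd" assume X: "X \<longlonglongrightarrow> x"
  interpret prob_space Q using Q borel_probD by blast
  note [simp] = borel_probD(2)[OF Q] borel_probD(3)[OF Q]
  have ob: "orthant y \<in> sets Q" for y :: "real ^ 'd" by simp
  have AE: "AE y in Q. \<forall>i. y $ i \<noteq> x $ i"
  proof (rule AE_all_countable[THEN iffD2, rule_format])
    fix i
    have "{y. y $ i = x $ i} \<in> sets borel" 
      by (intro borel_closed closed_Collect_eq continuous_intros)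
    then have "{y. y $ i = x $ i} \<in> null_sets Q" using null[of i] by (simp add: null_sets_def emeasure_eq_measure)
    then show "AE y in Q. y $ i \<noteq> x $ i" by (auto dest: AE_not_in)
  qed
  have "(\<lambda>k. \<integral>y. indicator (orthant (X k)) y \<partial>Q) \<longlonglongrightarrow> (\<integral>y. indicator (orthant x) y \<partial>Q :: real)"
  proof (rule integral_dominated_convergence[where w = "\<lambda>_. 1"])
    show "AE y in Q. (\<lambda>k. indicator (orthant (X k)) y :: real) \<longlonglongrightarrow> indicator (orthant x) y"
      using AE
    proof eventually_elim
      case (elim y)
      have "\<forall>\<^sub>F k in sequentially. (y $ i \<le> X k $ i) = (y $ i \<le> x $ i)" for i
      proof -
        have lim: "(\<lambda>k. X k $ i) \<longlonglongrightarrow> x $ i" using X by (rule tendsto_vec_nth)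
        show ?thesis
        proof (cases "y $ i < x $ i")
          case True
          show ?thesis using order_tendstoD(1)[OF lim True] by eventually_elim (use True in auto)
        next
          case False
          then have "x $ i < y $ i" using elim by (metis linorder_neqE)
          from order_tendstoD(2)[OF lim this] show ?thesis by eventually_elim (use False elim in auto)
        qed
      qed
      then have "\<forall>\<^sub>F k in sequentially. \<forall>i. (y $ i \<le> X k $ i) = (y $ i \<le> x $ i)"
        by (intro eventually_all_finite) auto
      then have "\<forall>\<^sub>F k in sequentially. indicator (orthant (X k)) y = (indicator (orthant x) y :: real)"
        by eventually_elim (auto simp: orthant_def indicator_def)
      then show ?case by (rule tendsto_eventually)
    qed
  qed (use ob in \<open>auto intro!: borel_measurable_indicator\<close>)
  then show "(distribution_function Q \<circ> X) \<longlonglongrightarrow> distribution_function Q x"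
    using ob by (simp add: o_def distribution_function_orthant)
qed

text \<open>
  The orthant at \<open>x\<close> differs from its open version \<open>J\<close> by a set containing the frontier.
  Approaching \<open>x\<close> along the diagonal from below, the orthants lie in \<open>J\<close>, so continuity
  of the distribution function forces \<open>J\<close> to have the full measure of the orthant.
\<close>

lemma continuity_set_orthant:
  fixes Q :: "(real ^ 'd) measure"
  assumes Q: "borel_prob Q" and cont: "isCont (distribution_function Q) x"
  shows "continuity_set Q (orthant x)"
proof -
  interpret prob_space Q using Q borel_probD by blast
  note [simp] = borel_probD(2)[OF Q] borel_probD(3)[OF Q]
  define X where "X k = (\<chi> i. x $ i - 1 / real (Suc k))" for k
  define J where "J = {y. \<forall>i. y $ i < x $ i}"
  have "open (\<Inter>i. {y. y $ i < x $ i})" by (intro open_INT ballI open_Collect_less continuous_intros) auto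
  then have J: "open J" by (simp add: J_def Collect_all_eq)
  have JO: "J \<subseteq> orthant x" by (auto simp: J_def orthant_def less_imp_le)
  have "(\<lambda>k. x $ i - 1 / real (Suc k)) \<longlonglongrightarrow> x $ i" for i by real_asymp
  then have "X \<longlonglongrightarrow> x" by (auto simp: X_def intro!: vec_tendstoI)
  then have lim: "(\<lambda>k. measure Q (orthant (X k))) \<longlonglongrightarrow> measure Q (orthant x)"
    using cont unfolding continuous_at_sequentially by (auto simp: o_def distribution_function_orthant)
  have "measure Q (orthant (X k)) \<le> measure Q J" for k
  proof (rule finite_measure_mono)
    have "x $ i - 1 / real (Suc k) < x $ i" for i by simp
    then show "orthant (X k) \<subseteq> J" unfolding orthant_def J_def X_def
      by (auto intro: le_less_trans)
  qed (use J in auto)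
  with lim have "measure Q (orthant x) \<le> measure Q J" by (auto intro: LIMSEQ_le_const2)
  moreover have "measure Q (orthant x - J) = measure Q (orthant x) - measure Q J"
    using J JO closed_orthant by (intro finite_measure_Diff) auto
  moreover have "frontier (orthant x) \<subseteq> orthant x - J"
    unfolding frontier_def using closure_closed[OF closed_orthant] interior_maximal[OF JO J] by auto
  then have "measure Q (frontier (orthant x)) \<le> measure Q (orthant x - J)"
    using J closed_orthant by (intro finite_measure_mono) auto
  ultimately have "measure Q (frontier (orthant x)) \<le> 0" by linarith
  then have "measure Q (frontier (orthant x)) = 0" using measure_nonneg[of Q] by (metis antisym)
  then show ?thesis using closed_orthant by (simp add: continuity_set_def)
qed

text \<open>
  Each marginal has at most countably many atoms, and there are only countably many measures
  and coordinates.
\<close>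

lemma common_continuity_coordinates_dense:
  fixes N :: "nat \<Rightarrow> (real ^ 'd) measure"
  assumes N: "\<And>p. p \<ge> 1 \<Longrightarrow> borel_prob (N p)" and "s < t"
  shows "\<exists>u\<in>{u. \<forall>p\<ge>1. \<forall>i. measure (N p) {y. y $ i = u} = 0}. s < u \<and> u < t"
proof -
  have "countable {u. measure (N p) {y. y $ i = u} \<noteq> 0}" if p: "p \<ge> 1" for p i
  proof -
    interpret prob_space "N p" using N[OF p] borel_probD by blast
    have m: "(\<lambda>y. y $ i) \<in> borel_measurable (N p)"
      by (intro borel_prob_measurable[OF N[OF p]] borel_measurable_continuous_onI continuous_intros)
    interpret D: prob_space "distr (N p) borel (\<lambda>y. y $ i)" using m by (rule prob_space_distr)
    show ?thesis
      using D.countable_support m borel_probD(3)[OF N[OF p]] by (simp add: measure_distr vimage_def)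
  qed
  then have "countable (\<Union>p\<in>{1..}. \<Union>i. {u. measure (N p) {y. y $ i = u} \<noteq> 0})"
    by (intro countable_UN) auto
  from open_minus_countable[OF this, of "{s<..<t}"] \<open>s < t\<close> show ?thesis
    by (simp add: Bex_def atLeast_def) blast
qed

section \<open>Uniform convergence along sequences\<close>

lemma abs_integral_le:
  fixes f :: "'a::topological_space \<Rightarrow> real"
  assumes Q: "borel_prob Q" and f: "continuous_on UNIV f" and B: "\<And>x. \<bar>f x\<bar> \<le> B"
  shows "\<bar>\<integral>x. f x \<partial>Q\<bar> \<le> B"
proof -
  interpret prob_space Q using Q borel_probD by blast
  have "integrable Q f"
    using B borel_prob_measurable[OF Q borel_measurable_continuous_onI[OF f]]
    by (intro integrable_const_bound[where B=B]) auto
  then have "(\<integral>x. \<bar>f x\<bar> \<partial>Q) \<le> B" using B by (intro integral_le_const) auto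
  then show ?thesis using integral_abs_bound[of Q f] by linarith
qed

lemma converges_uniformly_over_p_cong:
  assumes "\<And>n p. n \<ge> 1 \<Longrightarrow> p \<ge> 1 \<Longrightarrow> a n p = a' n p" and "\<And>p. p \<ge> 1 \<Longrightarrow> b p = b' p"
  shows "converges_uniformly_over_p a b \<longleftrightarrow> converges_uniformly_over_p a' b'"
  unfolding converges_uniformly_over_p_def
proof (rule tendsto_cong)
  show "\<forall>\<^sub>F n in sequentially. (SUP p\<in>{1..}. \<bar>a n p - b p\<bar>) = (SUP p\<in>{1..}. \<bar>a' n p - b' p\<bar>)"
    using eventually_ge_at_top[of 1] by eventually_elim (intro SUP_cong, use assms in auto)
qed

locale tv_compact_limits =
  fixes M :: "nat \<Rightarrow> nat \<Rightarrow> 'a::topological_space measure" and N :: "nat \<Rightarrow> 'a measure"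
  assumes M: "\<And>n p. n \<ge> 1 \<Longrightarrow> p \<ge> 1 \<Longrightarrow> borel_prob (M n p)"
    and N: "\<And>p. p \<ge> 1 \<Longrightarrow> borel_prob (N p)"
    and compact: "tv_relatively_compact (N ` {1..})"
begin

text \<open>
  A choice of indices on which the approximation has to be tested: \<open>n\<close> tends to infinity while
  the limit measures at the indices \<open>p\<close> converge in total variation. The indices \<open>p k\<close>
  are arbitrary otherwise; they may repeat or be constant.
\<close>

definition limit_along :: "(nat \<Rightarrow> nat) \<Rightarrow> (nat \<Rightarrow> nat) \<Rightarrow> 'a measure \<Rightarrow> bool" where
  "limit_along n p \<nu> \<longleftrightarrow> strict_mono n \<and> (\<forall>k. 1 \<le> n k \<and> 1 \<le> p k) \<and>
     borel_prob \<nu> \<and> (\<lambda>k. tv_dist (N (p k)) \<nu>) \<longlonglongrightarrow> 0"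

lemma limit_alongD:
  assumes "limit_along n p \<nu>"
  shows "borel_prob (M (n k) (p k))" "borel_prob (N (p k))" "borel_prob \<nu>"
    "C \<in> sets borel \<Longrightarrow> (\<lambda>k. measure (N (p k)) C) \<longlonglongrightarrow> measure \<nu> C"
  using assms M N by (auto simp: limit_along_def intro!: measure_tendsto_of_tv_dist)

text \<open>
  This is where relative compactness enters. If the convergence is not uniform, then infinitely many
  \<open>n\<close> have a bad \<open>p\<close>; a subsequence of the resulting measures \<open>N p\<close> converges in total variation,
  and along it the difference does not vanish. The bound makes the real-valued
  supremum meaningful.
\<close>

lemma converges_uniformly_iff_along:
  assumes bdd: "\<And>n p. n \<ge> 1 \<Longrightarrow> p \<ge> 1 \<Longrightarrow> \<bar>a n p - b p\<bar> \<le> C"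
  shows "converges_uniformly_over_p a b \<longleftrightarrow>
    (\<forall>n p \<nu>. limit_along n p \<nu> \<longrightarrow> (\<lambda>k. a (n k) (p k) - b (p k)) \<longlonglongrightarrow> 0)" (is "_ \<longleftrightarrow> ?R")
proof
  define S where "S n = (SUP p\<in>{1..}. \<bar>a n p - b p\<bar>)" for n
  have le_S: "\<bar>a n p - b p\<bar> \<le> S n" if "n \<ge> 1" "p \<ge> 1" for n p
    unfolding S_def using that bdd by (intro cSUP_upper bdd_aboveI[of _ C]) auto
  have conv: "converges_uniformly_over_p a b \<longleftrightarrow> S \<longlonglongrightarrow> 0"
    by (simp add: converges_uniformly_over_p_def S_def[abs_def])
  show ?R if "converges_uniformly_over_p a b"
  proof (intro allI impI)
    fix n p \<nu> assume np: "limit_along n p \<nu>"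
    then have "(S \<circ> n) \<longlonglongrightarrow> 0"
      using that conv LIMSEQ_subseq_LIMSEQ by (auto simp: limit_along_def)
    then show "(\<lambda>k. a (n k) (p k) - b (p k)) \<longlonglongrightarrow> 0"
      by (rule Lim_null_comparison[rotated])
        (use np le_S in \<open>auto simp: limit_along_def\<close>)
  qed
  show "converges_uniformly_over_p a b" if R: ?R
  proof (rule ccontr)
    assume "\<not> converges_uniformly_over_p a b"
    then obtain e where e: "e > 0" and far: "\<And>m. \<exists>n\<ge>m. e \<le> \<bar>S n\<bar>"
      unfolding conv LIMSEQ_def by (auto simp: not_less)
    have "\<exists>p\<ge>1. e / 2 < \<bar>a n p - b p\<bar>" if "n \<ge> 1" "e \<le> \<bar>S n\<bar>" for n
    proof (rule ccontr)
      assume "\<not> ?thesis"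
      then have "S n \<le> e / 2" unfolding S_def by (intro cSUP_least) (auto simp: not_less)
      moreover have "0 \<le> S n" using le_S[of n 1] that by linarith
      ultimately show False using that e by linarith
    qed
    then have "\<exists>n\<ge>m. n \<ge> 1 \<and> (\<exists>p\<ge>1. e / 2 < \<bar>a n p - b p\<bar>)" for m
      using far[of "max 1 m"] by fastforce
    then have "infinite {n. n \<ge> 1 \<and> (\<exists>p\<ge>1. e / 2 < \<bar>a n p - b p\<bar>)}"
      by (auto simp: infinite_nat_iff_unbounded_le)
    then obtain n :: "nat \<Rightarrow> nat" where n: "strict_mono n" "\<And>k. n k \<ge> 1"
      and "\<And>k. \<exists>p\<ge>1. e / 2 < \<bar>a (n k) p - b p\<bar>"
      using infinite_enumerate by (smt (verit) mem_Collect_eq)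
    then obtain p where p: "\<And>k. p k \<ge> 1" "\<And>k. e / 2 < \<bar>a (n k) (p k) - b (p k)\<bar>" by metis
    have "range (\<lambda>k. N (p k)) \<subseteq> N ` {1..}" using p(1) by auto
    then obtain r \<nu> where r: "strict_mono r" "borel_prob \<nu>" "(\<lambda>k. tv_dist (N (p (r k))) \<nu>) \<longlonglongrightarrow> 0"
      using compact unfolding tv_relatively_compact_def by blast
    then have "limit_along (n \<circ> r) (p \<circ> r) \<nu>"
      using n p by (auto simp: limit_along_def strict_mono_o)
    then have "(\<lambda>k. a (n (r k)) (p (r k)) - b (p (r k))) \<longlonglongrightarrow> 0" using R by fastforce
    from tendstoD[OF this, of "e / 2"] e obtain k where "\<bar>a (n (r k)) (p (r k)) - b (p (r k))\<bar> < e / 2"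
      by (auto simp: eventually_sequentially)
    then show False using p(2)[of "r k"] by linarith
  qed
qed

lemma converges_uniformly_iff_tendsto_along:
  assumes bdd: "\<And>n p. n \<ge> 1 \<Longrightarrow> p \<ge> 1 \<Longrightarrow> \<bar>a n p - b p\<bar> \<le> C"
    and b: "\<And>n p \<nu>. limit_along n p \<nu> \<Longrightarrow> (\<lambda>k. b (p k)) \<longlonglongrightarrow> l \<nu>"
  shows "converges_uniformly_over_p a b \<longleftrightarrow>
    (\<forall>n p \<nu>. limit_along n p \<nu> \<longrightarrow> (\<lambda>k. a (n k) (p k)) \<longlonglongrightarrow> l \<nu>)"
proof -
  have "(\<lambda>k. a (n k) (p k) - b (p k)) \<longlonglongrightarrow> 0 \<longleftrightarrow> (\<lambda>k. a (n k) (p k)) \<longlonglongrightarrow> l \<nu>"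
    if "limit_along n p \<nu>" for n p \<nu>
    using b[OF that] Lim_transform_eq[of "\<lambda>k. a (n k) (p k)" "\<lambda>k. b (p k)" sequentially "l \<nu>"]
      tendsto_diff[of "\<lambda>k. a (n k) (p k)" "l \<nu>" sequentially "\<lambda>k. b (p k)" "l \<nu>"] by auto
  then show ?thesis using converges_uniformly_iff_along[of a b C, OF bdd] by auto
qed

text \<open>
  Along an admissible choice of indices the moving target, the integral against \<open>N (p k)\<close>, tends to
  the integral against \<open>\<nu>\<close>, so the target may be replaced by this constant.
\<close>

lemma converges_uniformly_integral_iff:
  fixes f :: "'a \<Rightarrow> real"
  assumes f: "continuous_on UNIV f" and bdd: "bounded (range f)"
  shows "converges_uniformly_over_p (\<lambda>n p. \<integral>x. f x \<partial>M n p) (\<lambda>p. \<integral>x. f x \<partial>N p) \<longleftrightarrow>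
    (\<forall>n p \<nu>. limit_along n p \<nu> \<longrightarrow> (\<lambda>k. \<integral>x. f x \<partial>M (n k) (p k)) \<longlonglongrightarrow> (\<integral>x. f x \<partial>\<nu>))"
proof -
  obtain B where B: "\<And>x. \<bar>f x\<bar> \<le> B" using bdd by (auto simp: bounded_iff)
  show ?thesis
  proof (rule converges_uniformly_iff_tendsto_along)
    fix n p :: nat assume np: "n \<ge> 1" "p \<ge> 1"
    show "\<bar>(\<integral>x. f x \<partial>M n p) - (\<integral>x. f x \<partial>N p)\<bar> \<le> 2 * B"
      using abs_integral_le[OF M[OF np] f B] abs_integral_le[OF N[OF np(2)] f B] by linarith
  next
    fix n p \<nu> assume "limit_along n p \<nu>"
    note D = limit_alongD[OF this]
    show "(\<lambda>k. \<integral>x. f x \<partial>N (p k)) \<longlonglongrightarrow> (\<integral>x. f x \<partial>\<nu>)"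
      by (intro integral_tendsto_of_open_liminf open_liminf_ge_if_setwise D f bdd) auto
  qed
qed

lemma converges_uniformly_measure_iff:
  assumes A: "A \<in> sets borel"
  shows "converges_uniformly_over_p (\<lambda>n p. measure (M n p) A) (\<lambda>p. measure (N p) A) \<longleftrightarrow>
    (\<forall>n p \<nu>. limit_along n p \<nu> \<longrightarrow> (\<lambda>k. measure (M (n k) (p k)) A) \<longlonglongrightarrow> measure \<nu> A)"
proof (rule converges_uniformly_iff_tendsto_along)
  fix n p :: nat assume np: "n \<ge> 1" "p \<ge> 1"
  interpret M: prob_space "M n p" using M[OF np] borel_probD by blast
  interpret N: prob_space "N p" using N[OF np(2)] borel_probD by blast
  show "\<bar>measure (M n p) A - measure (N p) A\<bar> \<le> 1"
    using M.prob_le_1[of A] N.prob_le_1[of A] measure_nonneg[of "M n p" A] measure_nonneg[of "N p" A]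
    by linarith
qed (use A limit_alongD(4) in blast)

lemma weak_conv_uniformly_of_open_liminf:
  assumes "\<And>n p \<nu>. limit_along n p \<nu> \<Longrightarrow> open_liminf_ge (\<lambda>k. M (n k) (p k)) \<nu>"
  shows "weak_conv_uniformly_over_p M N"
  unfolding weak_conv_uniformly_over_p_def
proof (intro allI impI, elim conjE)
  fix f :: "'a \<Rightarrow> real" assume f: "continuous_on UNIV f" "bounded (range f)"
  show "converges_uniformly_over_p (\<lambda>n p. \<integral>x. f x \<partial>M n p) (\<lambda>p. \<integral>x. f x \<partial>N p)"
    unfolding converges_uniformly_integral_iff[OF f]
  proof (intro allI impI)
    fix n p \<nu> assume np: "limit_along n p \<nu>"
    show "(\<lambda>k. \<integral>x. f x \<partial>M (n k) (p k)) \<longlonglongrightarrow> (\<integral>x. f x \<partial>\<nu>)"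
      by (rule integral_tendsto_of_open_liminf[OF limit_alongD(1)[OF np] limit_alongD(3)[OF np] assms[OF np] f])
  qed
qed

text \<open>
  A set that is a continuity set for every \<open>N p\<close> is one for \<open>\<nu>\<close> as well, since convergence in total
  variation carries null frontiers to the limit. Weak convergence of the \<open>N (p k)\<close> would not suffice for this.
\<close>

lemma measure_converges_uniformly_of_open_liminf:
  assumes "\<And>n p \<nu>. limit_along n p \<nu> \<Longrightarrow> open_liminf_ge (\<lambda>k. M (n k) (p k)) \<nu>"
    and A: "\<And>p. p \<ge> 1 \<Longrightarrow> continuity_set (N p) A"
  shows "converges_uniformly_over_p (\<lambda>n p. measure (M n p) A) (\<lambda>p. measure (N p) A)"
proof -
  have Ab: "A \<in> sets borel" using A[of 1] by (simp add: continuity_set_def)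
  have null: "measure \<nu> (frontier A) = 0" if np: "limit_along n p \<nu>" for n p \<nu>
  proof -
    have "measure (N (p k)) (frontier A) = 0" for k
      using A np by (auto simp: continuity_set_def limit_along_def)
    then show ?thesis
      using limit_alongD(4)[OF np, of "frontier A"] LIMSEQ_unique[OF _ tendsto_const] by simp
  qed
  show ?thesis
    unfolding converges_uniformly_measure_iff[OF Ab]
  proof (intro allI impI)
    fix n p \<nu> assume np: "limit_along n p \<nu>"
    show "(\<lambda>k. measure (M (n k) (p k)) A) \<longlonglongrightarrow> measure \<nu> A"
      by (rule continuity_set_tendsto[OF limit_alongD(1)[OF np] limit_alongD(3)[OF np] assms(1)[OF np] Ab null[OF np]])
  qed
qed

end

section \<open>The equivalences\<close>

text \<open>
  The hypothesis on \<open>\<phi>\<close> is implied both by convergence for bounded Lipschitz functions and by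
  convergence for compactly supported continuous functions, so one argument serves for both.
\<close>

lemma open_liminf_ge_of_uniform_test_functions:
  fixes M :: "nat \<Rightarrow> nat \<Rightarrow> 'a::euclidean_space measure"
  assumes "tv_compact_limits M N" and np: "tv_compact_limits.limit_along N n p \<nu>"
    and conv: "\<And>\<phi> :: 'a \<Rightarrow> real. \<And>L K. L-lipschitz_on UNIV \<phi> \<Longrightarrow> bounded (range \<phi>) \<Longrightarrow>
      compact K \<Longrightarrow> (\<And>x. x \<notin> K \<Longrightarrow> \<phi> x = 0) \<Longrightarrow>
      converges_uniformly_over_p (\<lambda>n p. \<integral>x. \<phi> x \<partial>M n p) (\<lambda>p. \<integral>x. \<phi> x \<partial>N p)"
  shows "open_liminf_ge (\<lambda>k. M (n k) (p k)) \<nu>"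
proof -
  interpret tv_compact_limits M N by fact
  show ?thesis
  proof (rule open_liminf_ge_of_test_functions[OF limit_alongD(1)[OF np] limit_alongD(3)[OF np]])
    fix \<phi> :: "'a \<Rightarrow> real" and L K
    assume lip: "L-lipschitz_on UNIV \<phi>" and ran: "\<And>x. 0 \<le> \<phi> x \<and> \<phi> x \<le> 1"
      and K: "compact K" "\<And>x. x \<notin> K \<Longrightarrow> \<phi> x = 0"
    have bdd: "bounded (range \<phi>)" unfolding bounded_iff by (rule exI[of _ 1]) (use ran in auto)
    show "(\<lambda>k. \<integral>x. \<phi> x \<partial>M (n k) (p k)) \<longlonglongrightarrow> (\<integral>x. \<phi> x \<partial>\<nu>)"
      using conv[OF lip bdd K] np
      unfolding converges_uniformly_integral_iff[OF lipschitz_on_continuous_on[OF lip] bdd] by blast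
  qed
qed

theorem theorem3:
  fixes M :: "nat \<Rightarrow> nat \<Rightarrow> (real ^ 'd) measure"
    and N :: "nat \<Rightarrow> (real ^ 'd) measure"
    and F :: "nat \<Rightarrow> nat \<Rightarrow> real ^ 'd \<Rightarrow> real"
    and G :: "nat \<Rightarrow> real ^ 'd \<Rightarrow> real"
  assumes M: "\<And>n p. n \<ge> 1 \<Longrightarrow> p \<ge> 1 \<Longrightarrow> borel_prob (M n p)"
    and N: "\<And>p. p \<ge> 1 \<Longrightarrow> borel_prob (N p)"
    and F: "\<And>n p. n \<ge> 1 \<Longrightarrow> p \<ge> 1 \<Longrightarrow> F n p = distribution_function (M n p)"
    and G: "\<And>p. p \<ge> 1 \<Longrightarrow> G p = distribution_function (N p)"
    and compact: "tv_relatively_compact (N ` {1..})"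
  defines "i \<equiv> weak_conv_uniformly_over_p M N"
    and "ii \<equiv> (\<forall>f :: real ^ 'd \<Rightarrow> real. bounded (range f) \<and> uniformly_continuous_on UNIV f \<longrightarrow>
           converges_uniformly_over_p (\<lambda>n p. \<integral>x. f x \<partial>M n p) (\<lambda>p. \<integral>x. f x \<partial>N p))"
    and "iii \<equiv> (\<forall>f :: real ^ 'd \<Rightarrow> real.
           continuous_on UNIV f \<and> (\<exists>K. compact K \<and> (\<forall>x. x \<notin> K \<longrightarrow> f x = 0)) \<longrightarrow>
           converges_uniformly_over_p (\<lambda>n p. \<integral>x. f x \<partial>M n p) (\<lambda>p. \<integral>x. f x \<partial>N p))"
    and "iv \<equiv> (\<forall>f :: real ^ 'd \<Rightarrow> real. bounded (range f) \<and> (\<exists>L. L-lipschitz_on UNIV f) \<longrightarrow>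
           converges_uniformly_over_p (\<lambda>n p. \<integral>x. f x \<partial>M n p) (\<lambda>p. \<integral>x. f x \<partial>N p))"
    and "v \<equiv> (\<forall>A \<in> sets borel. (\<forall>p\<ge>1. continuity_set (N p) A) \<longrightarrow>
           converges_uniformly_over_p (\<lambda>n p. measure (M n p) A) (\<lambda>p. measure (N p) A))"
    and "vi \<equiv> (\<forall>x. (\<forall>p\<ge>1. isCont (G p) x) \<longrightarrow>
           converges_uniformly_over_p (\<lambda>n p. F n p x) (\<lambda>p. G p x))"
  shows "(i \<longleftrightarrow> ii) \<and> (i \<longleftrightarrow> iii) \<and> (i \<longleftrightarrow> iv) \<and> (i \<longleftrightarrow> v) \<and> (i \<longleftrightarrow> vi)"
proof -
  have loc: "tv_compact_limits M N" by unfold_locales (use M N compact in auto)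
  interpret tv_compact_limits M N by (rule loc)
  \<comment> \<open>the sequential open-set condition through which all six conditions are compared\<close>
  define hub where "hub \<longleftrightarrow> (\<forall>n p \<nu>. limit_along n p \<nu> \<longrightarrow> open_liminf_ge (\<lambda>k. M (n k) (p k)) \<nu>)"
  have vi_iff: "vi \<longleftrightarrow> (\<forall>x. (\<forall>p\<ge>1. isCont (distribution_function (N p)) x) \<longrightarrow>
      converges_uniformly_over_p (\<lambda>n p. measure (M n p) (orthant x)) (\<lambda>p. measure (N p) (orthant x)))"
    unfolding vi_def
    using converges_uniformly_over_p_cong[of "\<lambda>n p. F n p x" "\<lambda>n p. measure (M n p) (orthant x)"
        "\<lambda>p. G p x" "\<lambda>p. measure (N p) (orthant x)" for x]
    by (simp add: F G distribution_function_orthant)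
  have "i \<Longrightarrow> ii"
    unfolding i_def ii_def weak_conv_uniformly_over_p_def
    by (auto intro: uniformly_continuous_imp_continuous)
  moreover have "ii \<Longrightarrow> iv"
    unfolding ii_def iv_def by (auto intro: lipschitz_on_uniformly_continuous)
  moreover have "iv \<Longrightarrow> hub"
    unfolding iv_def hub_def
    by (intro allI impI open_liminf_ge_of_uniform_test_functions[OF loc]) auto
  moreover have "i \<Longrightarrow> iii"
    unfolding i_def iii_def weak_conv_uniformly_over_p_def
  proof (intro allI impI, elim conjE exE)
    fix f :: "real ^ 'd \<Rightarrow> real" and K
    assume i: "\<forall>f :: real ^ 'd \<Rightarrow> real. continuous_on UNIV f \<and> bounded (range f) \<longrightarrow>
        converges_uniformly_over_p (\<lambda>n p. \<integral>x. f x \<partial>M n p) (\<lambda>p. \<integral>x. f x \<partial>N p)"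
      and f: "continuous_on UNIV f" and K: "compact K" "\<forall>x. x \<notin> K \<longrightarrow> f x = 0"
    have "bounded (f ` K)"
      using f K by (intro compact_imp_bounded compact_continuous_image) (auto intro: continuous_on_subset)
    then have "bounded (insert 0 (f ` K))" by simp
    moreover have "range f \<subseteq> insert 0 (f ` K)" using K by auto
    ultimately have "bounded (range f)" by (rule bounded_subset)
    with i f show "converges_uniformly_over_p (\<lambda>n p. \<integral>x. f x \<partial>M n p) (\<lambda>p. \<integral>x. f x \<partial>N p)" by blast
  qed
  moreover have "iii \<Longrightarrow> hub"
    unfolding iii_def hub_def
    by (intro allI impI open_liminf_ge_of_uniform_test_functions[OF loc])
      (auto intro: lipschitz_on_continuous_on)
  moreover have "hub \<Longrightarrow> i"
    unfolding hub_def i_def by (auto intro: weak_conv_uniformly_of_open_liminf)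
  moreover have "hub \<Longrightarrow> v"
    unfolding hub_def v_def by (auto intro: measure_converges_uniformly_of_open_liminf)
  moreover have "v \<Longrightarrow> vi"
    unfolding v_def vi_iff using continuity_set_orthant[OF N] orthant_borel by blast
  moreover have "vi \<Longrightarrow> hub"
    unfolding hub_def
  proof (intro allI impI)
    fix n p \<nu> assume vi: vi and np: "limit_along n p \<nu>"
    show "open_liminf_ge (\<lambda>k. M (n k) (p k)) \<nu>"
    proof (rule open_liminf_ge_of_orthants)
      show "borel_prob (M (n k) (p k))" "borel_prob \<nu>" for k using limit_alongD[OF np] by auto
      \<comment> \<open>Corners with these coordinates are continuity points of every distribution function.\<close>
      show "\<exists>u\<in>{u. \<forall>p\<ge>1. \<forall>i. measure (N p) {y. y $ i = u} = 0}. s < u \<and> u < t" if "s < t" for s t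
        using N that by (rule common_continuity_coordinates_dense)
    next
      fix x :: "real ^ 'd" assume "\<And>i. x $ i \<in> {u. \<forall>p\<ge>1. \<forall>i. measure (N p) {y. y $ i = u} = 0}"
      then have "isCont (distribution_function (N p)) x" if "p \<ge> 1" for p
        using that by (intro isCont_distribution_function N) auto
      then show "(\<lambda>k. measure (M (n k) (p k)) (orthant x)) \<longlonglongrightarrow> measure \<nu> (orthant x)"
        using vi np unfolding vi_iff converges_uniformly_measure_iff[OF orthant_borel] by blast
    qed
  qed
  ultimately show ?thesis by blast
qed

end
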